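(* Let $f \in \mathbf{F}_0$, let $E \subset \mathbb{R}^n$ be a measurable set with $0<|E|<\infty$, let $\gamma \in [0,n)$ and let $\alpha \in (0,|E|^{\gamma/n})$. If $f$ is non-negative, then $$\mathbf{Med}^{\alpha,\gamma}_E[f] = \left[\, R[f \chi_E]\left(\alpha |E|^{1-\gamma/n}\right),\ L[f \chi_E]\left(\alpha |E|^{1-\gamma/n}\right) \right],$$ where the right-hand side is a closed interval of real numbers.
   Context: $|\cdot|$ denotes Lebesgue measure on $\mathbb{R}^n$ and $\chi_E$ is the characteristic function of $E$. For a measurable function $f$ on $\mathbb{R}^n$, $d_f(\lambda) := |\{x\in\mathbb{R}^n : |f(x)|>\lambda\}|$ for $\lambda\ge 0$. $\mathbf{F}$ is the set of all Lebesgue measurable functions $f$ on $\mathbb{R}^n$ with $|f(x)|<\infty$ for a.e. $x$ and $d_f(\lambda)<\infty$ for all $\lambda\in(0,\infty)$. $\mathbf{F}_0$ is the set of all $f\in\mathbf{F}$ such that for every bounded $E\subset\mathbb{R}^n$, $d_{f\chi_E}(\lambda)\to 0$ as $\lambda\to\infty$. Non-increasing rearrangements: for $f\in\mathbf{F}$ and $t\ge 0$, $$R[f](t) := \inf\{\lambda\ge 0 : d_f(\lambda)\le t\},\qquad L[f](t) := \inf\{\lambda\ge 0 : d_f(\lambda)<t\},\qquad \inf\emptyset:=\infty.$$ Fractional medians: for $E\subset\mathbb{R}^n$ measurable with $0<|E|<\infty$, $\gamma\in[0,n)$ and $\alpha\in(0,|E|^{\gamma/n})$, $\mathbf{Med}^{\alpha,\gamma}_E[f]$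 is the set of all real numbers $m$ such that $$|\{x\in E : f(x)<m\}| \le |E|-\alpha|E|^{1-\gamma/n}\quad\text{and}\quad |\{x\in E : f(x)>m\}|\le \alpha|E|^{1-\gamma/n}.$$ *)

theory Defs
  imports "HOL-Analysis.Analysis"
begin

definition restr :: "(real^'n \<Rightarrow> ereal) \<Rightarrow> (real^'n) set \<Rightarrow> real^'n \<Rightarrow> ereal" where
  "restr f E = (\<lambda>x. f x * indicator E x)"  (* \<infinity> * 0 = 0 in ereal *)

definition dist_fun :: "(real^'n \<Rightarrow> ereal) \<Rightarrow> real \<Rightarrow> ennreal" where
  "dist_fun f l = emeasure lebesgue {x. \<bar>f x\<bar> > ereal l}"

definition space_F :: "(real^'n \<Rightarrow> ereal) set" where
  "space_F = {f. f \<in> borel_measurable lebesgue \<and>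
                 (AE x in lebesgue. \<bar>f x\<bar> < \<infinity>) \<and>
                 (\<forall>l>0. dist_fun f l < \<infinity>)}"

definition space_F0 :: "(real^'n \<Rightarrow> ereal) set" where
  "space_F0 = {f \<in> space_F. \<forall>E \<in> sets lebesgue. bounded E \<longrightarrow>
                 (dist_fun (restr f E) \<longlongrightarrow> 0) at_top}"

text \<open>The rearrangements take values in \<open>[0, \<infinity>]\<close>; the infimum is taken in the
  extended reals so that the infimum of the empty set is \<open>\<infinity>\<close>.\<close>

definition rearr_R :: "(real^'n \<Rightarrow> ereal) \<Rightarrow> real \<Rightarrow> ereal" where
  "rearr_R f t = Inf {ereal l | l. 0 \<le> l \<and> dist_fun f l \<le> ennreal t}"

definition rearr_L :: "(real^'n \<Rightarrow> ereal) \<Rightarrow> real \<Rightarrow> ereal" where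
  "rearr_L f t = Inf {ereal l | l. 0 \<le> l \<and> dist_fun f l < ennreal t}"

text \<open>Intended for \<open>E \<in> lmeasurable\<close> of positive measure, \<open>0 \<le> \<gamma> < n\<close> and
  \<open>0 < \<alpha> < |E| powr (\<gamma> / n)\<close>; all sets measured below then have finite measure.\<close>

definition frac_med ::
  "real \<Rightarrow> real \<Rightarrow> (real^'n) set \<Rightarrow> (real^'n \<Rightarrow> ereal) \<Rightarrow> real set" where
  "frac_med \<alpha> \<gamma> E f = {m.
     measure lebesgue {x \<in> E. f x < ereal m}
       \<le> measure lebesgue E - \<alpha> * measure lebesgue E powr (1 - \<gamma> / real CARD('n)) \<and>
     measure lebesgue {x \<in> E. f x > ereal m}
       \<le> \<alpha> * measure lebesgue E powr (1 - \<gamma> / real CARD('n))}"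

end

theory Submission
  imports Defs
begin

text \<open>Put \<open>t = \<alpha>|E|\<^bsup>1-\<gamma>/n\<^esup>\<close>, so that \<open>0 < t < |E|\<close>, and \<open>g l = |{x \<in> E. f x > l}|\<close>.
  Then \<open>m\<close> is a fractional median iff \<open>g m \<le> t\<close> and \<open>|{x \<in> E. f x \<ge> m}| \<ge> t\<close>; the former
  forces \<open>m \<ge> 0\<close>. As \<open>g\<close> is non-increasing and continuous from the right, \<open>g m \<le> t\<close>
  holds iff \<open>m\<close> is at least \<open>R[f \<chi>\<^sub>E](t)\<close>. As \<open>|{x \<in> E. f x \<ge> m}|\<close> is the limit of \<open>g\<close> at \<open>m\<close>
  from the left, the second condition holds iff no \<open>l < m\<close> satisfies \<open>g l < t\<close>, that is, iff
  \<open>m\<close> is at most \<open>L[f \<chi>\<^sub>E](t)\<close>. The latter is finite because \<open>|E|\<close> is and \<open>f\<close> is finite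
  almost everywhere, whence \<open>g\<close> tends to \<open>0\<close>.\<close>

lemma sets_superlevel_within:
  fixes f :: "'a \<Rightarrow> ereal"
  assumes [measurable]: "f \<in> borel_measurable M" "E \<in> sets M"
  shows "{x \<in> E. c < f x} \<in> sets M" "{x \<in> E. c \<le> f x} \<in> sets M"
proof -
  have "{x \<in> E. c < f x} = {x \<in> space M. x \<in> E \<and> c < f x}"
    and "{x \<in> E. c \<le> f x} = {x \<in> space M. x \<in> E \<and> c \<le> f x}"
    using sets.sets_into_space[OF assms(2)] by auto
  then show "{x \<in> E. c < f x} \<in> sets M" "{x \<in> E. c \<le> f x} \<in> sets M"
    by simp_all
qed

lemma emeasure_subset_finite:
  assumes "E \<in> sets M" "emeasure M E < \<infinity>" "A \<subseteq> E"
  shows "emeasure M A \<noteq> \<infinity>"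
  using emeasure_mono[OF assms(3,1)] assms(2) by (metis order_le_less_trans less_irrefl infinity_ennreal_def)

text \<open>Continuity from below: because \<open>a < f x\<close> is strict, the superlevel sets at
  \<open>a + 1 / Suc i\<close> increase to the one at \<open>a\<close>, and the bound
  \<open>t\<close> survives the limit.\<close>

lemma measure_superlevel_le_right:
  fixes f :: "'a \<Rightarrow> ereal" and a t :: real
  assumes f: "f \<in> borel_measurable M" and E: "E \<in> sets M" "emeasure M E < \<infinity>"
    and le: "\<And>l. a < l \<Longrightarrow> measure M {x \<in> E. ereal l < f x} \<le> t"
  shows "measure M {x \<in> E. ereal a < f x} \<le> t"
proof -
  define A where "A i = {x \<in> E. ereal (a + 1 / real (Suc i)) < f x}" for i
  have "(\<Union>i. A i) = {x \<in> E. ereal a < f x}"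
  proof (intro equalityI subsetI)
    fix x assume "x \<in> (\<Union>i. A i)"
    then obtain i where "x \<in> E" "ereal (a + 1 / real (Suc i)) < f x"
      by (auto simp: A_def)
    moreover from this(2) have "ereal a < f x"
      by (rule less_trans[rotated]) simp
    ultimately show "x \<in> {x \<in> E. ereal a < f x}" by simp
  next
    fix x assume x: "x \<in> {x \<in> E. ereal a < f x}"
    \<comment> \<open>The value \<open>f x\<close> may be infinite, so the room above
      \<open>a\<close> is measured up to a real \<open>r\<close> strictly between.\<close>
    then obtain r where r: "ereal a < ereal r" "ereal r < f x"
      using ereal_dense2[of "ereal a" "f x"] by auto
    then obtain i where "1 / real (Suc i) < r - a"
      using nat_approx_posE[of "r - a"] by auto
    then have "ereal (a + 1 / real (Suc i)) < ereal r" by simp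
    also note r(2)
    finally have "x \<in> A i" using x by (simp add: A_def)
    then show "x \<in> (\<Union>i. A i)" by blast
  qed
  moreover have "incseq A"
  proof (rule incseq_SucI, rule subsetI)
    fix i x assume "x \<in> A i"
    moreover have "ereal (a + 1 / real (Suc (Suc i))) \<le> ereal (a + 1 / real (Suc i))"
      by (simp add: frac_le)
    ultimately show "x \<in> A (Suc i)" by (auto simp: A_def simp del: of_nat_Suc ereal_less_eq)
  qed
  moreover have "range A \<subseteq> sets M"
    using sets_superlevel_within[OF f E(1)] by (auto simp: A_def)
  moreover have "emeasure M (\<Union>i. A i) \<noteq> \<infinity>"
    by (rule emeasure_subset_finite[OF E]) (auto simp: A_def)
  ultimately have "(\<lambda>i. measure M (A i)) \<longlonglongrightarrow> measure M {x \<in> E. ereal a < f x}"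
    using Lim_measure_incseq[of A M] by simp
  then show ?thesis
    by (rule LIMSEQ_le_const2) (auto simp: A_def simp del: of_nat_Suc intro!: le)
qed

text \<open>Continuity from above, available because \<open>E\<close> has finite measure: the strict
  superlevel sets at \<open>m - 1 / Suc i\<close> decrease to the non-strict one at
  \<open>m\<close>.\<close>

lemma measure_superlevel_ge_left:
  fixes f :: "'a \<Rightarrow> ereal" and m t :: real
  assumes f: "f \<in> borel_measurable M" and E: "E \<in> sets M" "emeasure M E < \<infinity>"
    and ge: "\<And>l. l < m \<Longrightarrow> t \<le> measure M {x \<in> E. ereal l < f x}"
  shows "t \<le> measure M {x \<in> E. ereal m \<le> f x}"
proof -
  define A where "A i = {x \<in> E. ereal (m - 1 / real (Suc i)) < f x}" for i
  have "(\<Inter>i. A i) = {x \<in> E. ereal m \<le> f x}"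
  proof (intro equalityI subsetI)
    fix x assume x: "x \<in> (\<Inter>i. A i)"
    have "ereal m \<le> f x"
    proof (rule ccontr)
      assume "\<not> ereal m \<le> f x"
      then have "f x < ereal m" by simp
      then obtain r where r: "f x < ereal r" "ereal r < ereal m"
        using ereal_dense2[of "f x" "ereal m"] by blast
      then obtain i where "1 / real (Suc i) < m - r"
        using nat_approx_posE[of "m - r"] by auto
      then have "ereal r < ereal (m - 1 / real (Suc i))" by simp
      also have "\<dots> < f x" using x by (auto simp: A_def)
      finally show False using r by auto
    qed
    with x show "x \<in> {x \<in> E. ereal m \<le> f x}" by (auto simp: A_def)
  next
    fix x assume x: "x \<in> {x \<in> E. ereal m \<le> f x}"
    have "ereal (m - 1 / real (Suc i)) < f x" for i
      by (rule less_le_trans[of _ "ereal m"]) (use x in auto)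
    with x show "x \<in> (\<Inter>i. A i)" by (simp add: A_def)
  qed
  moreover have "decseq A"
  proof (rule decseq_SucI, rule subsetI)
    fix i x assume "x \<in> A (Suc i)"
    moreover have "ereal (m - 1 / real (Suc i)) \<le> ereal (m - 1 / real (Suc (Suc i)))"
      by (simp add: frac_le)
    ultimately show "x \<in> A i" by (auto simp: A_def simp del: of_nat_Suc ereal_less_eq)
  qed
  moreover have "range A \<subseteq> sets M"
    using sets_superlevel_within[OF f E(1)] by (auto simp: A_def)
  moreover have "emeasure M (A i) \<noteq> \<infinity>" for i
    by (rule emeasure_subset_finite[OF E]) (auto simp: A_def)
  ultimately have "(\<lambda>i. measure M (A i)) \<longlonglongrightarrow> measure M {x \<in> E. ereal m \<le> f x}"
    using Lim_measure_decseq[of A M] by simp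
  then show ?thesis
    by (rule LIMSEQ_le_const) (auto simp: A_def simp del: of_nat_Suc intro!: ge)
qed

text \<open>Continuity from above once more: a point lying in all these sets has
  \<open>f x = \<infinity>\<close>, so their intersection is a null set.\<close>

lemma measure_superlevel_tendsto_0:
  fixes f :: "'a \<Rightarrow> ereal"
  assumes f: "f \<in> borel_measurable M" and E: "E \<in> sets M" "emeasure M E < \<infinity>"
    and fin: "AE x in M. \<bar>f x\<bar> < \<infinity>"
  shows "(\<lambda>i. measure M {x \<in> E. ereal (real i) < f x}) \<longlonglongrightarrow> 0"
proof -
  define A where "A i = {x \<in> E. ereal (real i) < f x}" for i
  have sets: "range A \<subseteq> sets M"
    using sets_superlevel_within[OF f E(1)] by (auto simp: A_def)
  have infinite: "f x = \<infinity>" if "x \<in> (\<Inter>i. A i)" for x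
  proof (cases "f x")
    case (real r)
    with that have "real i < r" for i by (auto simp: A_def)
    then show ?thesis using reals_Archimedean2[of r] by (meson less_asym)
  qed (use that in \<open>auto simp: A_def\<close>)
  have "x \<notin> (\<Inter>i. A i)" if "\<bar>f x\<bar> < \<infinity>" for x
  proof
    assume "x \<in> (\<Inter>i. A i)"
    from infinite[OF this] that show False by simp
  qed
  with fin have "AE x in M. x \<notin> (\<Inter>i. A i)"
    by (rule eventually_mono)
  moreover have "(\<Inter>i. A i) \<in> sets M" using sets by auto
  ultimately have "measure M (\<Inter>i. A i) = 0"
    by (simp add: AE_iff_null_sets measure_eq_0_null_sets)
  moreover have "decseq A"
  proof (rule decseq_SucI, rule subsetI)
    fix i x assume "x \<in> A (Suc i)"
    then have "x \<in> E" "ereal (real (Suc i)) < f x" by (simp_all add: A_def)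
    moreover from this(2) have "ereal (real i) < f x"
      by (rule less_trans[rotated]) simp
    ultimately show "x \<in> A i" by (simp add: A_def)
  qed
  moreover have "emeasure M (A i) \<noteq> \<infinity>" for i
    by (rule emeasure_subset_finite[OF E]) (auto simp: A_def)
  ultimately show ?thesis
    using Lim_measure_decseq[of A M] sets by (simp add: A_def)
qed

text \<open>Off \<open>E\<close> the restricted function is 0 and never exceeds
  \<open>l \<ge> 0\<close>; on \<open>E\<close> the absolute value disappears since \<open>f\<close>
  is non-negative. Finiteness of the measure of \<open>E\<close> permits the passage to real
  values.\<close>

lemma dist_fun_restr:
  fixes f :: "real^'n \<Rightarrow> ereal"
  assumes "E \<in> sets lebesgue" "emeasure lebesgue E < \<infinity>" "\<forall>x. 0 \<le> f x" "0 \<le> l"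
  shows "dist_fun (restr f E) l = ennreal (measure lebesgue {x \<in> E. ereal l < f x})"
proof -
  have "{x. ereal l < \<bar>restr f E x\<bar>} = {x \<in> E. ereal l < f x}"
    using assms(3,4) by (auto simp: restr_def indicator_def split: if_splits)
  then have "dist_fun (restr f E) l = emeasure lebesgue {x \<in> E. ereal l < f x}"
    by (simp only: dist_fun_def)
  also have "\<dots> = ennreal (measure lebesgue {x \<in> E. ereal l < f x})"
  proof (rule emeasure_eq_ennreal_measure)
    show "emeasure lebesgue {x \<in> E. ereal l < f x} \<noteq> top"
      using emeasure_subset_finite[OF assms(1,2), of "{x \<in> E. ereal l < f x}"] by auto
  qed
  finally show ?thesis .
qed

theorem theorem3p1:
  fixes f :: "real^'n \<Rightarrow> ereal" and E :: "(real^'n) set" and \<gamma> \<alpha> :: real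
  assumes "f \<in> space_F0"
    and "E \<in> sets lebesgue" and "0 < emeasure lebesgue E" and "emeasure lebesgue E < \<infinity>"
    and "0 \<le> \<gamma>" and "\<gamma> < real CARD('n)"
    and "0 < \<alpha>" and "\<alpha> < measure lebesgue E powr (\<gamma> / real CARD('n))"
    and "\<forall>x. 0 \<le> f x"
  shows "\<exists>a b :: real.
           rearr_R (restr f E) (\<alpha> * measure lebesgue E powr (1 - \<gamma> / real CARD('n))) = ereal a \<and>
           rearr_L (restr f E) (\<alpha> * measure lebesgue E powr (1 - \<gamma> / real CARD('n))) = ereal b \<and>
           a \<le> b \<and> frac_med \<alpha> \<gamma> E f = {a..b}"
proof -
  define t where "t = \<alpha> * measure lebesgue E powr (1 - \<gamma> / real CARD('n))"
  define g where "g l = measure lebesgue {x \<in> E. ereal l < f x}" for l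
  define A where "A = {l. 0 \<le> l \<and> g l \<le> t}"
  define B where "B = {l. 0 \<le> l \<and> g l < t}"
  note E = assms(2,4)
  have f: "f \<in> borel_measurable lebesgue" and fin: "AE x in lebesgue. \<bar>f x\<bar> < \<infinity>"
    using assms(1) by (auto simp: space_F0_def space_F_def)
  have Em: "E \<in> lmeasurable" using E by (simp add: fmeasurable_def)
  have pos: "0 < measure lebesgue E"
    using assms(3,4) by (metis emeasure_eq_ennreal_measure ennreal_less_zero_iff infinity_ennreal_def less_irrefl)
  have t0: "0 < t" using assms(7) pos by (simp add: t_def)
  \<comment> \<open>The exponents on the right add up to 1, so the upper bound on
    \<open>\<alpha>\<close> says precisely that \<open>t\<close> is below the measure of
    \<open>E\<close>.\<close>
  have "t < measure lebesgue E powr (\<gamma> / real CARD('n)) * measure lebesgue E powr (1 - \<gamma> / real CARD('n))"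
    using assms(8) pos by (simp add: t_def)
  also have "\<dots> = measure lebesgue E"
    using pos by (simp flip: powr_add)
  finally have tE: "t < measure lebesgue E" .
  have lm: "{x \<in> E. c < f x} \<in> lmeasurable" "{x \<in> E. c \<le> f x} \<in> lmeasurable" for c
    using sets_superlevel_within[OF f E(1)] emeasure_subset_finite[OF E, of "{x \<in> E. c < f x}"]
      emeasure_subset_finite[OF E, of "{x \<in> E. c \<le> f x}"]
    by (auto simp: fmeasurable_def top.not_eq_extremum)
  have g_mono: "g k \<le> g l" if "l \<le> k" for l k
    unfolding g_def
  proof (rule measure_mono_fmeasurable)
    show "{x \<in> E. ereal k < f x} \<subseteq> {x \<in> E. ereal l < f x}"
      using that by (auto intro: le_less_trans[of "ereal l" "ereal k"])
  qed (rule fmeasurableD lm)+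
  \<comment> \<open>The rearrangements only see levels \<open>l \<ge> 0\<close>. Below 0 the value
    of \<open>g\<close> exceeds \<open>t\<close>, which excludes negative medians and settles
    negative levels in \<open>lower\<close>.\<close>
  have g_neg: "g l = measure lebesgue E" if "l < 0" for l
  proof -
    have "ereal l < f x" for x
      using that assms(9) by (auto intro: less_le_trans[of _ 0])
    then show ?thesis by (simp add: g_def)
  qed
  have "\<forall>\<^sub>F i in sequentially. g (real i) < t"
    using measure_superlevel_tendsto_0[OF f E fin] t0
    by (auto simp: g_def intro: order_tendstoD)
  then obtain i :: nat where "g (real i) < t"
    by (auto simp: eventually_sequentially)
  \<comment> \<open>Since \<open>B\<close>, and with it \<open>A\<close>, is nonempty and bounded
    below by 0, the infima in the extended reals are the real numbers \<open>Inf A\<close> and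
    \<open>Inf B\<close>.\<close>
  then have B: "B \<noteq> {}" unfolding B_def by force
  have BA: "B \<subseteq> A" by (auto simp: A_def B_def)
  with B have A: "A \<noteq> {}" by auto
  have bdd: "bdd_below A" "bdd_below B"
    by (auto simp: A_def B_def intro: bdd_belowI[of _ 0])
  have R: "rearr_R (restr f E) t = ereal (Inf A)"
  proof -
    have "{ereal l | l. 0 \<le> l \<and> dist_fun (restr f E) l \<le> ennreal t} = ereal ` A"
      using t0 by (auto simp: A_def g_def dist_fun_restr[OF E assms(9)] ennreal_le_iff)
    then show ?thesis
      using ereal_Inf'[OF bdd(1) A] by (simp add: rearr_R_def)
  qed
  have L: "rearr_L (restr f E) t = ereal (Inf B)"
  proof -
    have "{ereal l | l. 0 \<le> l \<and> dist_fun (restr f E) l < ennreal t} = ereal ` B"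
      using t0 by (auto simp: B_def g_def dist_fun_restr[OF E assms(9)] ennreal_less_iff)
    then show ?thesis
      using ereal_Inf'[OF bdd(2) B] by (simp add: rearr_L_def)
  qed
  have upper: "g m \<le> t \<longleftrightarrow> Inf A \<le> m" for m
  proof
    assume "g m \<le> t"
    moreover from this have "0 \<le> m" using g_neg[of m] tE by linarith
    ultimately have "m \<in> A" by (simp add: A_def)
    then show "Inf A \<le> m" using bdd(1) by (rule cInf_lower)
  next
    assume m: "Inf A \<le> m"
    \<comment> \<open>Monotonicity controls only levels strictly above \<open>Inf A\<close>;
      continuity from the right then includes the endpoint \<open>m = Inf A\<close>.\<close>
    have "g l \<le> t" if "m < l" for l
    proof -
      have "Inf A < l" using m that by simp
      then obtain k where "k \<in> A" "k < l" using cInf_lessD[OF A] by blast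
      then show ?thesis using g_mono[of k l] by (auto simp: A_def)
    qed
    then show "g m \<le> t"
      using measure_superlevel_le_right[OF f E, of m t] by (simp add: g_def)
  qed
  have lower: "t \<le> measure lebesgue {x \<in> E. ereal m \<le> f x} \<longleftrightarrow> m \<le> Inf B" for m
  proof
    assume m: "t \<le> measure lebesgue {x \<in> E. ereal m \<le> f x}"
    show "m \<le> Inf B"
    proof (rule cInf_greatest[OF B], rule ccontr)
      fix l assume l: "l \<in> B" "\<not> m \<le> l"
      \<comment> \<open>An \<open>l < m\<close> in \<open>B\<close> would give measure at most
        \<open>g l < t\<close> to the set where \<open>f x \<ge> m\<close>.\<close>
      have "measure lebesgue {x \<in> E. ereal m \<le> f x} \<le> g l"
        unfolding g_def
      proof (rule measure_mono_fmeasurable)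
        show "{x \<in> E. ereal m \<le> f x} \<subseteq> {x \<in> E. ereal l < f x}"
          using l(2) by (auto intro: less_le_trans[of "ereal l" "ereal m"])
      qed (rule fmeasurableD lm)+
      with l(1) m show False by (simp add: B_def)
    qed
  next
    assume m: "m \<le> Inf B"
    have "t \<le> g l" if "l < m" for l
    proof (cases "l < 0")
      case False
      have "l \<notin> B" using cInf_lower[OF _ bdd(2), of l] m that by auto
      with False show ?thesis by (auto simp: B_def)
    qed (use g_neg tE in simp)
    then show "t \<le> measure lebesgue {x \<in> E. ereal m \<le> f x}"
      using measure_superlevel_ge_left[OF f E, of m t] by (simp add: g_def)
  qed
  \<comment> \<open>Passing to the complement in \<open>E\<close> cancels the measure of
    \<open>E\<close> in the first median condition and turns it into the left side of
    \<open>lower\<close>.\<close>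
  have compl: "measure lebesgue {x \<in> E. f x < ereal m} =
      measure lebesgue E - measure lebesgue {x \<in> E. ereal m \<le> f x}" for m
  proof -
    have "{x \<in> E. f x < ereal m} = E - {x \<in> E. ereal m \<le> f x}" by auto
    then show ?thesis
      using measurable_measure_Diff[OF Em, of "{x \<in> E. ereal m \<le> f x}"] lm(2)
      by (simp add: fmeasurable_def)
  qed
  have "frac_med \<alpha> \<gamma> E f = {m. t \<le> measure lebesgue {x \<in> E. ereal m \<le> f x} \<and> g m \<le> t}"
    unfolding frac_med_def compl g_def t_def[symmetric]
    by (intro Collect_cong conj_cong iffI) linarith+
  also have "\<dots> = {Inf A..Inf B}"
    unfolding upper lower atLeastAtMost_def atLeast_def atMost_def by blast
  finally have "frac_med \<alpha> \<gamma> E f = {Inf A..Inf B}" .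
  \<comment> \<open>The smaller set has the larger infimum, so the interval is nonempty.\<close>
  moreover have "Inf A \<le> Inf B"
    using B bdd(1) BA by (rule cInf_superset_mono)
  ultimately show ?thesis
    using R L by (auto simp flip: t_def)
qed

end
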